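(* Let $H$ be a separable infinite dimensional complex Hilbert space and let $\langle d_n\rangle_{n=1}^\infty$ be a sequence of complex numbers. There exist a nonzero finite rank idempotent $D\in B(H)$ and an orthonormal basis $\{b_n\}_{n=1}^\infty$ of $H$ with $(Db_n,b_n)=d_n$ for all $n\in\mathbb{N}$ if and only if $\sum_{n=1}^\infty |d_n|<\infty$ and $\sum_{n=1}^\infty d_n$ is a positive integer.
   Context: An idempotent is a bounded operator $D$ with $D^2=D$, not necessarily self-adjoint. $(\cdot,\cdot)$ is the inner product of $H$. *)

theory Defs
  imports "HOL-Analysis.Analysis"
begin

(* The class real_inner supplies the norm, metric and topology.  The last axiom makes
   its real inner product the real part of the complex one, so the norm of x is
   sqrt (Re (cinner x x)); see cinner_self.  The complex inner product is linear in its
   first argument. *)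
class complex_hilbert_space = real_inner + complete_space +
  fixes scaleC :: "complex \<Rightarrow> 'a \<Rightarrow> 'a" (infixr "*\<^sub>C" 75)
    and cinner :: "'a \<Rightarrow> 'a \<Rightarrow> complex"
  assumes scaleC_add_right: "a *\<^sub>C (x + y) = a *\<^sub>C x + a *\<^sub>C y"
    and scaleC_add_left: "(a + b) *\<^sub>C x = a *\<^sub>C x + b *\<^sub>C x"
    and scaleC_scaleC: "a *\<^sub>C (b *\<^sub>C x) = (a * b) *\<^sub>C x"
    and scaleC_complex_of_real: "complex_of_real r *\<^sub>C x = r *\<^sub>R x"
    and cinner_commute: "cinner x y = cnj (cinner y x)"
    and cinner_add_left: "cinner (x + y) z = cinner x z + cinner y z"
    and cinner_scaleC_left: "cinner (a *\<^sub>C x) y = a * cinner x y"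
    and inner_eq_Re_cinner: "inner x y = Re (cinner x y)"

lemma scaleC_one: "1 *\<^sub>C x = (x :: 'a::complex_hilbert_space)"
  using scaleC_complex_of_real[of 1 x] by simp

lemma cinner_self:
  "cinner x x = complex_of_real ((norm (x :: 'a::complex_hilbert_space))\<^sup>2)"
proof -
  have "Im (cinner x x) = - Im (cinner x x)"
    by (subst cinner_commute) simp
  moreover have "Re (cinner x x) = (norm x)\<^sup>2"
    by (simp add: power2_norm_eq_inner inner_eq_Re_cinner)
  ultimately show ?thesis by (simp add: complex_eq_iff)
qed

global_interpretation complex_vector:
  vector_space "scaleC :: complex \<Rightarrow> 'a \<Rightarrow> 'a::complex_hilbert_space"
  by unfold_locales
    (simp_all add: scaleC_add_right scaleC_add_left scaleC_scaleC scaleC_one)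

abbreviation cspan :: "'a::complex_hilbert_space set \<Rightarrow> 'a set"
  where "cspan \<equiv> complex_vector.span"

(* Membership in B(H). *)
definition bounded_clinear ::
    "('a::complex_hilbert_space \<Rightarrow> 'b::complex_hilbert_space) \<Rightarrow> bool"
  where "bounded_clinear T \<longleftrightarrow>
    Vector_Spaces.linear scaleC scaleC T \<and> (\<exists>K. \<forall>x. norm (T x) \<le> K * norm x)"

definition idempotent_operator :: "('a::complex_hilbert_space \<Rightarrow> 'a) \<Rightarrow> bool"
  where "idempotent_operator D \<longleftrightarrow> bounded_clinear D \<and> D \<circ> D = D"

definition finite_rank ::
    "('a::complex_hilbert_space \<Rightarrow> 'b::complex_hilbert_space) \<Rightarrow> bool"
  where "finite_rank T \<longleftrightarrow> (\<exists>B. finite B \<and> range T \<subseteq> cspan B)"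

definition orthonormal_basis :: "(nat \<Rightarrow> 'a::complex_hilbert_space) \<Rightarrow> bool"
  where "orthonormal_basis b \<longleftrightarrow>
    (\<forall>m n. cinner (b m) (b n) = (if m = n then 1 else 0)) \<and>
    closure (cspan (range b)) = UNIV"

end

theory Submission
  imports Defs
begin

text \<open>
  If D is a nonzero idempotent of finite rank m and (e i) is an orthonormal basis of its range,
  then d n is the sum over i < m of (e i, b n) (D (b n), e i). Bessel's inequality, applied to the
  bounded functionals x \<mapsto> (D x, e i), gives absolute summability, and expanding e i in the
  basis b shows that the i-th term contributes (D (e i), e i) = 1 to the sum.

  Conversely, D x is taken to be the sum over i < k of (x, w i) (v i) for a biorthogonal system
  v i = b i + q, w i = b i + cnj (1 - d i) (b k) + (if i = 0 then p else 0), in any orthonormal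
  basis b. The coordinates of q are d n - 1 for n < k and 1 for n = k, which makes the first k
  diagonal entries correct and q orthogonal to b i + cnj (1 - d i) (b k) for all i < k. For
  n > k the coordinates of q and of p are chosen so that the n-th term of (q, p) is d n. The
  remaining coordinate of p, at k, makes p orthogonal to q; since the sum of d is k, this also
  produces the diagonal entry d k.
\<close>

section \<open>Sesquilinearity, Cauchy-Schwarz and continuity of the complex inner product\<close>

lemma cinner_add_right: "cinner x (y + z) = cinner x y + cinner x z"
  by (metis cinner_commute cinner_add_left complex_cnj_add)

lemma cinner_scaleC_right: "cinner x (a *\<^sub>C y) = cnj a * cinner x y"
  by (metis cinner_commute cinner_scaleC_left complex_cnj_mult)

lemma norm_scaleC: "norm (a *\<^sub>C x) = cmod a * norm (x :: 'a::complex_hilbert_space)"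
proof -
  have "cinner (a *\<^sub>C x) (a *\<^sub>C x) = a * cnj a * cinner x x"
    by (simp add: cinner_scaleC_left cinner_scaleC_right)
  then have "complex_of_real ((norm (a *\<^sub>C x))\<^sup>2) = complex_of_real ((cmod a * norm x)\<^sup>2)"
    by (simp add: cinner_self power_mult_distrib flip: complex_norm_square)
  then have "(norm (a *\<^sub>C x))\<^sup>2 = (cmod a * norm x)\<^sup>2"
    using of_real_eq_iff by blast
  then show ?thesis
    by (simp add: power2_eq_iff_nonneg)
qed

lemma cinner_scaleR_left: "cinner (r *\<^sub>R x) y = r *\<^sub>R cinner x y"
  by (metis cinner_scaleC_left scaleC_complex_of_real scaleR_conv_of_real)

lemma cinner_scaleR_right: "cinner x (r *\<^sub>R y) = r *\<^sub>R cinner x y"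
  by (metis cinner_scaleC_right scaleC_complex_of_real scaleR_conv_of_real complex_cnj_complex_of_real)

text \<open>Multiplying \<open>x\<close> by the conjugate of \<open>cinner x y\<close> makes the
  inner product real and nonnegative, so the real Cauchy-Schwarz inequality applies; one factor
  \<open>cmod z\<close> then cancels.\<close>

lemma cinner_cauchy_schwarz: "cmod (cinner x y) \<le> norm x * norm y"
proof (cases "cinner x y = 0")
  case False
  define z where "z = cinner x y"
  have "cmod z * cmod z = Re (cinner (cnj z *\<^sub>C x) y)"
    by (simp add: cinner_scaleC_left flip: z_def)
      (metis cmod_power2 power2_eq_square)
  also have "\<dots> = inner (cnj z *\<^sub>C x) y"
    by (simp add: inner_eq_Re_cinner)
  also have "\<dots> \<le> cmod z * (norm x * norm y)"
    using norm_cauchy_schwarz[of "cnj z *\<^sub>C x" y] by (simp add: norm_scaleC mult.assoc)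
  finally show ?thesis
    using False by (simp add: z_def)
qed simp

lemma bounded_linear_cinner_left: "bounded_linear (\<lambda>x. cinner x y)"
  by (rule bounded_linear_intro[of _ "norm y"])
    (auto simp: cinner_add_left cinner_scaleR_left cinner_cauchy_schwarz)

text \<open>Conjugate linearity in the second argument is no obstacle, since
  \<open>bounded_linear\<close> means linear over the reals.\<close>

lemma bounded_linear_cinner_right: "bounded_linear (\<lambda>y. cinner x y)"
  by (rule bounded_linear_intro[of _ "norm x"])
    (auto simp: cinner_add_right cinner_scaleR_right cinner_cauchy_schwarz mult.commute[of _ "norm x"])

lemmas cinner_sum_left = linear_sum[OF bounded_linear.linear, OF bounded_linear_cinner_left]
  and cinner_sum_right = linear_sum[OF bounded_linear.linear, OF bounded_linear_cinner_right]
  and cinner_diff_left = linear_diff[OF bounded_linear.linear, OF bounded_linear_cinner_left]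
  and cinner_diff_right = linear_diff[OF bounded_linear.linear, OF bounded_linear_cinner_right]
  and cinner_zero_left [simp] = linear_0[OF bounded_linear.linear, OF bounded_linear_cinner_left]
  and cinner_zero_right [simp] = linear_0[OF bounded_linear.linear, OF bounded_linear_cinner_right]

lemma bounded_linear_scaleC_left: "bounded_linear (\<lambda>a. a *\<^sub>C x)"
proof (rule bounded_linear_intro[of _ "norm x"])
  show "(r *\<^sub>R a) *\<^sub>C x = r *\<^sub>R a *\<^sub>C x" for r a
    by (simp only: scaleR_conv_of_real scaleC_scaleC[symmetric] scaleC_complex_of_real)
qed (simp_all add: scaleC_add_left norm_scaleC)

lemma norm_eq_1_iff_cinner: "norm x = 1 \<longleftrightarrow> cinner x x = 1"
  by (metis cinner_self norm_ge_zero of_real_eq_1_iff power2_eq_1_iff abs_of_nonneg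
      one_power2 power2_eq_iff_nonneg zero_le_one)

section \<open>Finite sums in an orthonormal system\<close>

text \<open>The index set lets one notion serve both the finite families \<open>{..<m}\<close> and
  whole sequences, with \<open>I = UNIV\<close>.\<close>

definition orthonormal_on :: "nat set \<Rightarrow> (nat \<Rightarrow> 'a::complex_hilbert_space) \<Rightarrow> bool"
  where "orthonormal_on I e \<longleftrightarrow>
    (\<forall>m\<in>I. \<forall>n\<in>I. cinner (e m) (e n) = (if m = n then 1 else 0))"

lemma cinner_orthonormal_sum:
  assumes "orthonormal_on I e" "finite J" "J \<subseteq> I" "i \<in> I"
  shows "cinner (\<Sum>n\<in>J. a n *\<^sub>C e n) (e i) = (if i \<in> J then a i else 0)"
proof -
  have "cinner (\<Sum>n\<in>J. a n *\<^sub>C e n) (e i) = (\<Sum>n\<in>J. if n = i then a n else 0)"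
    unfolding cinner_sum_left
    using assms by (intro sum.cong) (auto simp: cinner_scaleC_left orthonormal_on_def)
  then show ?thesis
    using assms by simp
qed

lemma norm_orthonormal_sum:
  assumes "orthonormal_on I e" "finite J" "J \<subseteq> I"
  shows "(norm (\<Sum>n\<in>J. a n *\<^sub>C e n))\<^sup>2 = (\<Sum>n\<in>J. (cmod (a n))\<^sup>2)"
proof -
  let ?x = "\<Sum>n\<in>J. a n *\<^sub>C e n"
  have "cinner ?x ?x = (\<Sum>n\<in>J. cnj (a n) * cinner ?x (e n))"
    by (subst (2) sum.cong[OF refl]) (simp_all add: cinner_sum_right cinner_scaleC_right)
  also have "\<dots> = (\<Sum>n\<in>J. cnj (a n) * a n)"
    using assms by (intro sum.cong refl) (auto simp: cinner_orthonormal_sum subsetD)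
  also have "\<dots> = complex_of_real (\<Sum>n\<in>J. (cmod (a n))\<^sup>2)"
    by (simp add: mult.commute flip: complex_norm_square)
  finally show ?thesis
    unfolding cinner_self using of_real_eq_iff by blast
qed

lemma cspan_orthonormal_expansion:
  assumes e: "orthonormal_on I e" "finite J" "J \<subseteq> I" and x: "x \<in> cspan (e ` J)"
  shows "(\<Sum>n\<in>J. cinner x (e n) *\<^sub>C e n) = x"
  using x
proof (induction rule: complex_vector.span_induct_alt)
  case base
  then show ?case by simp
next
  case (step c v y)
  then obtain j where j: "j \<in> J" "v = e j" by auto
  have "(\<Sum>n\<in>J. cinner (c *\<^sub>C e j + y) (e n) *\<^sub>C e n)
      = (\<Sum>n\<in>J. (if n = j then c *\<^sub>C e n else 0) + cinner y (e n) *\<^sub>C e n)"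
    using e j by (intro sum.cong refl)
      (auto simp: cinner_add_left cinner_scaleC_left scaleC_add_left orthonormal_on_def subset_iff)
  also have "\<dots> = c *\<^sub>C e j + y"
    using e j step by (simp add: sum.distrib)
  finally show ?case using j by simp
qed

text \<open>The span is the fixed-point set of the orthogonal projection onto it, which is
  continuous.\<close>

lemma closed_cspan_orthonormal:
  assumes "orthonormal_on I e" "finite J" "J \<subseteq> I"
  shows "closed (cspan (e ` J))"
proof -
  have "cspan (e ` J) = {x. (\<Sum>n\<in>J. cinner x (e n) *\<^sub>C e n) = x}" (is "_ = ?R")
  proof
    show "cspan (e ` J) \<subseteq> ?R"
      using cspan_orthonormal_expansion[OF assms] by blast
    show "?R \<subseteq> cspan (e ` J)"
      by (smt (verit) complex_vector.span_base complex_vector.span_scale complex_vector.span_sum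
          imageI mem_Collect_eq subsetI)
  qed
  moreover have "closed ?R"
  proof (rule closed_Collect_eq)
    show "continuous_on UNIV (\<lambda>x. \<Sum>n\<in>J. cinner x (e n) *\<^sub>C e n)"
      by (intro linear_continuous_on bounded_linear_sum
          bounded_linear_compose[OF bounded_linear_scaleC_left bounded_linear_cinner_left])
  qed (rule continuous_on_id)
  ultimately show ?thesis by simp
qed

section \<open>Gram-Schmidt and the existence of an orthonormal basis\<close>

fun gram_schmidt :: "(nat \<Rightarrow> 'a::complex_hilbert_space) \<Rightarrow> nat \<Rightarrow> 'a" where
  "gram_schmidt f n = sgn (f n - (\<Sum>i<n. cinner (f n) (gram_schmidt f i) *\<^sub>C gram_schmidt f i))"

text \<open>The equation has no case distinction on \<open>n\<close>, so as a rewrite rule it would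
  unfold forever.\<close>

declare gram_schmidt.simps [simp del]

lemma gram_schmidt:
  assumes "inj_on f {..<m}" "complex_vector.independent (f ` {..<m})" "n \<le> m"
  shows "orthonormal_on {..<n} (gram_schmidt f)
    \<and> cspan (gram_schmidt f ` {..<n}) = cspan (f ` {..<n})"
  using assms(3)
proof (induction n)
  case 0
  then show ?case by (simp add: orthonormal_on_def)
next
  case (Suc n)
  define g where "g = gram_schmidt f"
  define p where "p = (\<Sum>i<n. cinner (f n) (g i) *\<^sub>C g i)"
  define u where "u = f n - p"
  have IH: "orthonormal_on {..<n} g" "cspan (g ` {..<n}) = cspan (f ` {..<n})"
    using Suc by (auto simp: g_def)
  have gn: "g n = sgn u"
    unfolding u_def p_def g_def by (subst gram_schmidt.simps) simp
  have p: "p \<in> cspan (g ` {..<n})"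
    unfolding p_def by (intro complex_vector.span_sum complex_vector.span_scale complex_vector.span_base) auto
  \<comment> \<open>Independence keeps \<open>f n\<close> out of the span of its predecessors, so
    the remainder \<open>u\<close> is nonzero and can be normalised.\<close>
  have "f ` {..<m} - {f n} \<supseteq> f ` {..<n}"
    using assms(1) Suc.prems by (fastforce simp: inj_on_def)
  moreover have "f n \<notin> cspan (f ` {..<m} - {f n})"
    using assms(2) Suc.prems unfolding complex_vector.dependent_def by auto
  ultimately have fn: "f n \<notin> cspan (f ` {..<n})"
    using complex_vector.span_mono by blast
  have u0: "u \<noteq> 0"
    using fn p IH(2) by (auto simp: u_def)
  have gu: "g n = complex_of_real (1 / norm u) *\<^sub>C u"
    by (simp add: gn sgn_div_norm scaleC_complex_of_real inverse_eq_divide del: of_real_divide)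
  have ug: "u = complex_of_real (norm u) *\<^sub>C g n"
    using u0 by (simp add: gn sgn_div_norm scaleC_complex_of_real)
  have orth: "cinner (g n) (g i) = 0" if "i < n" for i
  proof -
    have "cinner u (g i) = 0"
      using cinner_orthonormal_sum[OF IH(1), of "{..<n}" i "\<lambda>i. cinner (f n) (g i)"] that
      by (simp add: u_def p_def cinner_diff_left)
    then show ?thesis
      by (simp add: gu cinner_scaleC_left)
  qed
  then have orth': "cinner (g i) (g n) = 0" if "i < n" for i
    by (metis that cinner_commute complex_cnj_zero)
  have "norm (g n) = 1"
    using u0 by (simp add: gn norm_sgn)
  then have "orthonormal_on {..<Suc n} g"
    using IH(1) orth orth' by (auto simp: orthonormal_on_def norm_eq_1_iff_cinner less_Suc_eq)
  moreover have "cspan (g ` {..<Suc n}) = cspan (f ` {..<Suc n})"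
  proof -
    have "cspan (insert (g n) (g ` {..<n})) = cspan (insert u (g ` {..<n}))"
    proof (rule complex_vector.span_eq[THEN iffD2], safe)
      show "g n \<in> cspan (insert u (g ` {..<n}))"
        unfolding gu by (intro complex_vector.span_scale complex_vector.span_base) auto
      show "u \<in> cspan (insert (g n) (g ` {..<n}))"
        by (subst ug) (intro complex_vector.span_scale complex_vector.span_base; auto)
    qed (auto intro: complex_vector.span_base)
    \<comment> \<open>\<open>u\<close> and \<open>f n\<close> differ by \<open>p\<close>, which lies
      in the span of the earlier vectors.\<close>
    also have "\<dots> = cspan (insert (f n) (g ` {..<n}))"
      using p by (intro complex_vector.eq_span_insert_eq) (simp add: u_def complex_vector.span_neg)
    also have "\<dots> = cspan (insert (f n) (f ` {..<n}))"
      using IH(2) by (simp add: complex_vector.span_insert)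
    finally show ?thesis by (simp add: lessThan_Suc)
  qed
  ultimately show ?case by (simp add: g_def)
qed

lemma finite_orthonormal_span:
  fixes B :: "'a::complex_hilbert_space set"
  assumes "finite B"
  obtains e :: "nat \<Rightarrow> 'a" and m :: nat
  where "orthonormal_on {..<m} e" "cspan (e ` {..<m}) = cspan B"
proof -
  obtain C where C: "C \<subseteq> B" "complex_vector.independent C" "B \<subseteq> cspan C"
    using complex_vector.maximal_independent_subset by blast
  have "finite C"
    using C(1) assms by (rule finite_subset)
  then obtain f where f: "bij_betw f {..<card C} C"
    using ex_bij_betw_nat_finite[of C] by (auto simp: atLeast0LessThan)
  then have "inj_on f {..<card C}" "f ` {..<card C} = C"
    by (auto simp: bij_betw_def)
  then have "orthonormal_on {..<card C} (gram_schmidt f)"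
    "cspan (gram_schmidt f ` {..<card C}) = cspan C"
    using gram_schmidt[of f "card C" "card C"] C(2) by auto
  moreover have "cspan C = cspan B"
    using C by (meson complex_vector.span_eq complex_vector.span_superset subset_trans)
  ultimately show thesis
    using that by metis
qed

lemma closed_cspan_finite:
  fixes B :: "'a::complex_hilbert_space set"
  assumes "finite B"
  shows "closed (cspan B)"
proof -
  obtain e :: "nat \<Rightarrow> 'a" and m where "orthonormal_on {..<m} e" "cspan (e ` {..<m}) = cspan B"
    using assms by (rule finite_orthonormal_span)
  then show ?thesis
    using closed_cspan_orthonormal[of "{..<m}" e "{..<m}"] by simp
qed

text \<open>A maximal independent subset of a countable dense set has dense span; Gram-Schmidt along
  an enumeration of it keeps that span.\<close>

lemma orthonormal_basis_exists:
  fixes A :: "'a::complex_hilbert_space set"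
  assumes A: "countable A" "closure A = UNIV"
    and inf: "\<nexists>B :: 'a set. finite B \<and> cspan B = UNIV"
  obtains b :: "nat \<Rightarrow> 'a" where "orthonormal_basis b"
proof -
  obtain C where C: "C \<subseteq> A" "complex_vector.independent C" "A \<subseteq> cspan C"
    using complex_vector.maximal_independent_subset by blast
  have dense: "closure (cspan C) = UNIV"
    using closure_mono[OF C(3)] A(2) by auto
  \<comment> \<open>The span of a finite set is closed; being dense, it would be the whole
    space.\<close>
  have "infinite C"
    using inf dense closed_cspan_finite[of C] by (metis closure_closed)
  moreover have "countable C"
    using C(1) A(1) by (rule countable_subset)
  ultimately obtain f :: "nat \<Rightarrow> 'a" where f: "bij_betw f UNIV C"
    using bij_betw_from_nat_into by blast
  define b where "b = gram_schmidt f"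
  have gs: "orthonormal_on {..<n} b \<and> cspan (b ` {..<n}) = cspan (f ` {..<n})" for n
    unfolding b_def
  proof (rule gram_schmidt[of f n n])
    show "inj_on f {..<n}"
      using f by (auto simp: bij_betw_def inj_on_def)
    show "complex_vector.independent (f ` {..<n})"
      using f C(2) complex_vector.independent_mono[of C "f ` {..<n}"] by (auto simp: bij_betw_def)
  qed simp
  have "C \<subseteq> cspan (range b)"
  proof
    fix x assume "x \<in> C"
    then obtain n where "x = f n"
      using f by (auto simp: bij_betw_def)
    then have "x \<in> cspan (f ` {..<Suc n})"
      by (auto intro: complex_vector.span_base)
    also have "\<dots> = cspan (b ` {..<Suc n})"
      using gs by simp
    also have "\<dots> \<subseteq> cspan (range b)"
      by (intro complex_vector.span_mono) auto
    finally show "x \<in> cspan (range b)" .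
  qed
  then have "cspan C \<subseteq> cspan (range b)"
    by (simp add: complex_vector.span_minimal)
  then have "closure (cspan (range b)) = UNIV"
    using dense closure_mono by blast
  moreover have "cinner (b m) (b n) = (if m = n then 1 else 0)" for m n
    using gs[of "Suc (max m n)"] unfolding orthonormal_on_def
    by (metis lessThan_iff max.cobounded1 max.cobounded2 le_imp_less_Suc)
  ultimately show thesis
    using that unfolding orthonormal_basis_def by blast
qed

section \<open>Orthonormal expansions, Bessel's inequality and Parseval's identity\<close>

lemma orthonormal_basis_imp_orthonormal:
  "orthonormal_basis b \<Longrightarrow> orthonormal_on UNIV b"
  by (simp add: orthonormal_basis_def orthonormal_on_def)

text \<open>The remainder is orthogonal to the projection, so Pythagoras applies.\<close>

lemma norm_orthonormal_remainder_le:
  assumes "orthonormal_on I e" "finite J" "J \<subseteq> I"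
  shows "norm (x - (\<Sum>n\<in>J. cinner x (e n) *\<^sub>C e n)) \<le> norm x"
proof -
  define p where "p = (\<Sum>n\<in>J. cinner x (e n) *\<^sub>C e n)"
  have "cinner p (e n) = cinner x (e n)" if "n \<in> J" for n
    using cinner_orthonormal_sum[OF assms, of n] that assms(3) by (auto simp: p_def)
  then have "cinner (x - p) p = 0"
    by (subst (2) p_def)
      (simp add: cinner_sum_right cinner_scaleC_right cinner_diff_left)
  then have "inner (x - p) p = 0"
    by (simp add: inner_eq_Re_cinner)
  then have "(norm x)\<^sup>2 = (norm (x - p))\<^sup>2 + (norm p)\<^sup>2"
    using norm_add_Pythagorean[of "x - p" p] by (simp add: orthogonal_def)
  then have "(norm (x - p))\<^sup>2 \<le> (norm x)\<^sup>2"
    by simp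
  then show ?thesis
    unfolding p_def[symmetric] by (rule power2_le_imp_le) simp
qed

text \<open>For large \<open>n\<close> the partial-sum projection fixes a nearby \<open>y\<close>
  from the span, so the remainder of \<open>x\<close> equals that of \<open>x - y\<close>, which is
  no longer than \<open>x - y\<close>.\<close>

lemma orthonormal_basis_expansion:
  assumes b: "orthonormal_basis b"
  shows "(\<lambda>n. cinner x (b n) *\<^sub>C b n) sums x"
  unfolding sums_def
proof (rule LIMSEQ_I)
  fix r :: real assume r: "r > 0"
  have o: "orthonormal_on UNIV b"
    using b by (rule orthonormal_basis_imp_orthonormal)
  have "x \<in> closure (cspan (range b))"
    using b by (simp add: orthonormal_basis_def)
  then obtain y where y: "y \<in> cspan (range b)" "dist y x < r"
    using r by (auto simp: closure_approachable)
  then obtain F where F: "finite F" "F \<subseteq> range b" "y \<in> cspan F"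
    unfolding complex_vector.span_explicit by blast
  then obtain I where I: "finite I" "F = b ` I"
    by (meson finite_subset_image)
  then obtain N where N: "I \<subseteq> {..<N}"
    using finite_nat_iff_bounded by blast
  have "norm ((\<Sum>i<n. cinner x (b i) *\<^sub>C b i) - x) < r" if "n \<ge> N" for n
  proof -
    let ?P = "\<lambda>x. \<Sum>i<n. cinner x (b i) *\<^sub>C b i"
    have "F \<subseteq> b ` {..<n}"
      using I(2) N that by auto
    then have "y \<in> cspan (b ` {..<n})"
      using F(3) complex_vector.span_mono by blast
    then have "?P y = y"
      by (intro cspan_orthonormal_expansion[OF o]) auto
    moreover have "?P (x - y) = ?P x - ?P y"
      by (simp add: cinner_diff_left complex_vector.scale_left_diff_distrib sum_subtractf)
    moreover have "norm ((x - y) - ?P (x - y)) \<le> norm (x - y)"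
      by (rule norm_orthonormal_remainder_le[OF o]) auto
    ultimately have "norm (x - ?P x) \<le> norm (x - y)"
      by simp
    then show ?thesis
      using y(2) by (simp add: dist_norm norm_minus_commute)
  qed
  then show "\<exists>no. \<forall>n\<ge>no. norm ((\<Sum>i<n. cinner x (b i) *\<^sub>C b i) - x) < r"
    by blast
qed

lemma bounded_clinear_imp_bounded_linear:
  assumes "bounded_clinear T"
  shows "bounded_linear T"
proof -
  interpret T: Vector_Spaces.linear scaleC scaleC T
    using assms by (simp add: bounded_clinear_def)
  obtain K where K: "\<And>x. norm (T x) \<le> K * norm x"
    using assms by (auto simp: bounded_clinear_def)
  show ?thesis
  proof (rule bounded_linear_intro)
    show "T (r *\<^sub>R x) = r *\<^sub>R T x" for r x
      by (metis T.scale scaleC_complex_of_real)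
    show "norm (T x) \<le> norm x * K" for x
      using K[of x] by (simp add: mult.commute)
  qed (rule T.add)
qed

lemma bounded_clinear_scaleC: "bounded_clinear T \<Longrightarrow> T (a *\<^sub>C x) = a *\<^sub>C T x"
proof -
  assume "bounded_clinear T"
  then interpret T: Vector_Spaces.linear scaleC scaleC T
    by (simp add: bounded_clinear_def)
  show "T (a *\<^sub>C x) = a *\<^sub>C T x"
    by (rule T.scale)
qed

text \<open>Bessel's inequality for the functional x \<mapsto> (T x, y): testing it on the vector
  whose coordinates are the conjugates of the values (T (b n), y) avoids the adjoint of T.\<close>

lemma orthonormal_bessel_summable:
  assumes T: "bounded_clinear T" and b: "orthonormal_on UNIV b"
  shows "summable (\<lambda>n. (cmod (cinner (T (b n)) y))\<^sup>2)"
proof -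
  obtain K where K: "\<And>x. norm (T x) \<le> K * norm x"
    using T by (auto simp: bounded_clinear_def)
  define c where "c n = cinner (T (b n)) y" for n
  have "(\<Sum>n<N. (cmod (c n))\<^sup>2) \<le> (K * norm y)\<^sup>2" for N
  proof -
    define S where "S = (\<Sum>n<N. (cmod (c n))\<^sup>2)"
    define z where "z = (\<Sum>n<N. cnj (c n) *\<^sub>C b n)"
    have S0: "S \<ge> 0"
      by (simp add: S_def sum_nonneg)
    have nz: "(norm z)\<^sup>2 = S"
      using norm_orthonormal_sum[OF b, of "{..<N}" "\<lambda>n. cnj (c n)"] by (simp add: z_def S_def)
    have "cinner (T z) y = (\<Sum>n<N. cnj (c n) * c n)"
      unfolding z_def linear_sum[OF bounded_linear.linear[OF bounded_clinear_imp_bounded_linear[OF T]]]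
      by (simp add: bounded_clinear_scaleC[OF T] cinner_sum_left cinner_scaleC_left c_def)
    also have "\<dots> = complex_of_real S"
      by (simp add: S_def mult.commute flip: complex_norm_square)
    finally have "S = cmod (cinner (T z) y)"
      using S0 by simp
    also have "\<dots> \<le> norm (T z) * norm y"
      by (rule cinner_cauchy_schwarz)
    also have "\<dots> \<le> K * norm z * norm y"
      by (intro mult_right_mono K) simp
    finally have "S\<^sup>2 \<le> (K * norm z * norm y)\<^sup>2"
      using S0 by (intro power_mono)
    also have "\<dots> = (K * norm y)\<^sup>2 * S"
      by (simp add: power_mult_distrib nz)
    finally have "S * S \<le> (K * norm y)\<^sup>2 * S"
      by (simp add: power2_eq_square)
    then show ?thesis
      using S0 by (cases "S = 0") (simp_all add: S_def[symmetric])
  qed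
  then show ?thesis
    unfolding c_def by (intro summableI_nonneg_bounded) auto
qed

text \<open>With the identity for \<open>T\<close>, the results on \<open>cinner (T (b n)) y\<close>
  become the classical ones of Bessel and Parseval.\<close>

lemma bounded_clinear_id: "bounded_clinear (\<lambda>x :: 'a::complex_hilbert_space. x)"
proof -
  have "Vector_Spaces.linear scaleC scaleC (\<lambda>x :: 'a. x)"
    by unfold_locales simp_all
  moreover have "\<forall>x :: 'a. norm x \<le> 1 * norm x"
    by simp
  ultimately show ?thesis
    unfolding bounded_clinear_def by blast
qed

lemma summable_norm_mult_square_summable:
  assumes "summable (\<lambda>n. (cmod (f n))\<^sup>2)" "summable (\<lambda>n. (cmod (g n))\<^sup>2)"
  shows "summable (\<lambda>n. cmod (f n * g n))"
proof (rule summable_comparison_test)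
  have "cmod (f n) * cmod (g n) \<le> (cmod (f n))\<^sup>2 + (cmod (g n))\<^sup>2" for n
    using sum_squares_bound[of "cmod (f n)" "cmod (g n)"] mult_nonneg_nonneg[OF norm_ge_zero[of "f n"] norm_ge_zero[of "g n"]]
    by linarith
  then show "\<exists>N. \<forall>n\<ge>N. norm (cmod (f n * g n)) \<le> (cmod (f n))\<^sup>2 + (cmod (g n))\<^sup>2"
    by (simp add: norm_mult)
qed (intro summable_add assms)

text \<open>The continuous functional taking \<open>x\<close> to \<open>cinner (T x) y\<close> is
  applied termwise to the expansion of \<open>x\<close>. Absolute summability holds because both
  factors are square summable.\<close>

lemma orthonormal_basis_parseval:
  assumes T: "bounded_clinear T" and b: "orthonormal_basis b"
  shows "(\<lambda>n. cinner x (b n) * cinner (T (b n)) y) sums cinner (T x) y"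
    and "summable (\<lambda>n. cmod (cinner x (b n) * cinner (T (b n)) y))"
proof -
  have "bounded_linear (\<lambda>x. cinner (T x) y)"
    by (intro bounded_linear_compose[OF bounded_linear_cinner_left] bounded_clinear_imp_bounded_linear T)
  from bounded_linear.sums[OF this orthonormal_basis_expansion[OF b, of x]]
  show "(\<lambda>n. cinner x (b n) * cinner (T (b n)) y) sums cinner (T x) y"
    by (simp add: bounded_clinear_scaleC[OF T] cinner_scaleC_left)
  have o: "orthonormal_on UNIV b"
    using b by (rule orthonormal_basis_imp_orthonormal)
  have "cmod (cinner x (b n)) = cmod (cinner (b n) x)" for n
    by (subst cinner_commute) simp
  then show "summable (\<lambda>n. cmod (cinner x (b n) * cinner (T (b n)) y))"
    using orthonormal_bessel_summable[OF bounded_clinear_id o, of x]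
    by (intro summable_norm_mult_square_summable orthonormal_bessel_summable[OF T o]) simp
qed

section \<open>Necessity: the diagonal of a finite rank idempotent\<close>

text \<open>\<open>m\<close> is the dimension of the range, which is the trace of \<open>D\<close>.
  The implication for \<open>m = 0\<close> is what yields positivity when \<open>D\<close> is
  nonzero.\<close>

lemma finite_rank_idempotent_diagonal:
  fixes D :: "'a::complex_hilbert_space \<Rightarrow> 'a"
  assumes D: "idempotent_operator D" "finite_rank D" and b: "orthonormal_basis b"
  obtains m :: nat where "m = 0 \<longrightarrow> D = (\<lambda>x. 0)"
    "(\<lambda>n. cinner (D (b n)) (b n)) sums of_nat m"
    "summable (\<lambda>n. cmod (cinner (D (b n)) (b n)))"
proof -
  have T: "bounded_clinear D" and DD: "D (D x) = D x" for x
    using D(1) by (auto simp: idempotent_operator_def fun_eq_iff)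
  interpret D: Vector_Spaces.linear scaleC scaleC D
    using T by (simp add: bounded_clinear_def)
  obtain B where B: "finite B" "range D \<subseteq> cspan B"
    using D(2) by (auto simp: finite_rank_def)
  obtain C where C: "C \<subseteq> range D" "complex_vector.independent C" "range D \<subseteq> cspan C"
    using complex_vector.maximal_independent_subset by blast
  \<comment> \<open>\<open>B\<close> spans a space that may exceed the range, whereas
    \<open>C\<close> is a basis of the range; independence inside \<open>cspan B\<close> bounds its
    size.\<close>
  have "finite C"
    using complex_vector.independent_span_bound[OF B(1) C(2)] C(1) B(2) by blast
  then obtain e :: "nat \<Rightarrow> 'a" and m where e: "orthonormal_on {..<m} e" "cspan (e ` {..<m}) = cspan C"
    by (rule finite_orthonormal_span)
  have "complex_vector.subspace (range D)"
    by (rule D.subspace_image) simp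
  then have "cspan C \<subseteq> range D"
    using C(1) by (simp add: complex_vector.span_minimal)
  then have De: "D (e i) = e i" if "i < m" for i
  proof -
    have "e i \<in> cspan (e ` {..<m})"
      using that by (intro complex_vector.span_base) simp
    then have "e i \<in> range D"
      using e(2) \<open>cspan C \<subseteq> range D\<close> by blast
    then show ?thesis
      using DD by auto
  qed
  have diag: "cinner (D x) x = (\<Sum>i<m. cinner (e i) x * cinner (D x) (e i))" for x
  proof -
    have "D x \<in> cspan (e ` {..<m})"
      using C(3) e(2) by auto
    then have "D x = (\<Sum>i<m. cinner (D x) (e i) *\<^sub>C e i)"
      using cspan_orthonormal_expansion[OF e(1), of "{..<m}"] by simp
    then have "cinner (D x) x = cinner (\<Sum>i<m. cinner (D x) (e i) *\<^sub>C e i) x"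
      by simp
    then show ?thesis
      by (simp add: cinner_sum_left cinner_scaleC_left mult.commute)
  qed
  show thesis
  proof
    show "m = 0 \<longrightarrow> D = (\<lambda>x. 0)"
      using C(3) e(2) by (fastforce simp: fun_eq_iff)
    \<comment> \<open>Parseval with \<open>x = y = e i\<close>, summed over the finitely many
      \<open>i\<close>.\<close>
    have "(\<lambda>n. \<Sum>i<m. cinner (e i) (b n) * cinner (D (b n)) (e i)) sums (\<Sum>i<m. cinner (D (e i)) (e i))"
      by (rule sums_sum) (rule orthonormal_basis_parseval(1)[OF T b])
    also have "(\<Sum>i<m. cinner (D (e i)) (e i)) = of_nat m"
      using De e(1) by (simp add: orthonormal_on_def)
    finally show "(\<lambda>n. cinner (D (b n)) (b n)) sums of_nat m"
      by (simp add: diag)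
    show "summable (\<lambda>n. cmod (cinner (D (b n)) (b n)))"
      unfolding diag
    proof (rule summable_comparison_test)
      show "summable (\<lambda>n. \<Sum>i<m. cmod (cinner (e i) (b n) * cinner (D (b n)) (e i)))"
        by (rule summable_sum) (rule orthonormal_basis_parseval(2)[OF T b])
    qed (auto intro: norm_sum)
  qed
qed

section \<open>Sufficiency: vectors with prescribed coordinates and the construction of the
  idempotent\<close>

text \<open>Makes the Cauchy criterion \<open>summable_Cauchy\<close> available for vector
  series.\<close>

instance complex_hilbert_space \<subseteq> banach ..

text \<open>Riesz-Fischer: the squared norm of a block of the vector series is the corresponding
  block of the square sum, so the series is Cauchy.\<close>

lemma orthonormal_vector_exists:
  fixes b :: "nat \<Rightarrow> 'a::complex_hilbert_space"
  assumes b: "orthonormal_on UNIV b" and a: "summable (\<lambda>n. (cmod (a n))\<^sup>2)"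
  obtains x where "\<And>n. cinner x (b n) = a n"
proof -
  have "summable (\<lambda>n. a n *\<^sub>C b n)"
    unfolding summable_Cauchy
  proof (intro allI impI)
    fix r :: real assume r: "r > 0"
    then obtain N where N: "\<And>m n. m \<ge> N \<Longrightarrow> norm (\<Sum>i=m..<n. (cmod (a i))\<^sup>2) < r\<^sup>2"
      using a unfolding summable_Cauchy by (meson zero_less_power)
    have "norm (\<Sum>i=m..<n. a i *\<^sub>C b i) < r" if "m \<ge> N" for m n
    proof -
      have "(norm (\<Sum>i=m..<n. a i *\<^sub>C b i))\<^sup>2 = (\<Sum>i=m..<n. (cmod (a i))\<^sup>2)"
        by (intro norm_orthonormal_sum[OF b]) auto
      also have "\<dots> < r\<^sup>2"
        using N[OF that, of n] by simp
      finally show ?thesis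
        using r by (rule power_less_imp_less_base[OF _ less_imp_le])
    qed
    then show "\<exists>N. \<forall>m\<ge>N. \<forall>n. norm (\<Sum>i=m..<n. a i *\<^sub>C b i) < r"
      by blast
  qed
  then obtain x where x: "(\<lambda>n. a n *\<^sub>C b n) sums x"
    by (auto simp: summable_def)
  have "cinner x (b n) = a n" for n
  proof -
    have "(\<lambda>i. cinner (a i *\<^sub>C b i) (b n)) sums cinner x (b n)"
      using bounded_linear.sums[OF bounded_linear_cinner_left x] .
    moreover have "(\<lambda>i. cinner (a i *\<^sub>C b i) (b n)) = (\<lambda>i. if i = n then a i else 0)"
      using b by (auto simp: cinner_scaleC_left orthonormal_on_def)
    ultimately have "(\<lambda>i. if i = n then a i else 0) sums cinner x (b n)"
      by simp
    then show ?thesis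
      using sums_single[of n a] by (rule sums_unique2)
  qed
  then show thesis by (rule that)
qed

text \<open>\<open>D\<close> is the oblique projection onto the span of the \<open>v i\<close> along
  the common kernel of the functionals given by the \<open>w i\<close>. It preserves the values of
  these functionals, and \<open>D x\<close> depends on nothing else.\<close>

lemma biorthogonal_idempotent:
  fixes v w :: "nat \<Rightarrow> 'a::complex_hilbert_space"
  assumes vw: "\<And>i j. i < k \<Longrightarrow> j < k \<Longrightarrow> cinner (v i) (w j) = (if i = j then 1 else 0)"
  defines "D \<equiv> \<lambda>x. \<Sum>i<k. cinner x (w i) *\<^sub>C v i"
  shows "idempotent_operator D" "finite_rank D" "k > 0 \<Longrightarrow> D \<noteq> (\<lambda>x. 0)"
proof -
  have "Vector_Spaces.linear scaleC scaleC D"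
    unfolding D_def by unfold_locales
      (simp_all add: cinner_add_left cinner_scaleC_left scaleC_add_left sum.distrib
        complex_vector.scale_sum_right scaleC_scaleC)
  moreover have "norm (D x) \<le> (\<Sum>i<k. norm (w i) * norm (v i)) * norm x" for x
  proof -
    have "norm (D x) \<le> (\<Sum>i<k. norm x * norm (w i) * norm (v i))"
      unfolding D_def
      by (intro sum_norm_le) (simp add: norm_scaleC mult_right_mono cinner_cauchy_schwarz)
    then show ?thesis
      by (simp add: sum_distrib_left sum_distrib_right mult_ac)
  qed
  ultimately have "bounded_clinear D"
    by (auto simp: bounded_clinear_def)
  have coord: "cinner (D x) (w j) = cinner x (w j)" if "j < k" for x j
  proof -
    have "cinner (D x) (w j) = (\<Sum>i<k. if i = j then cinner x (w i) else 0)"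
      unfolding D_def cinner_sum_left using that
      by (intro sum.cong) (auto simp: cinner_scaleC_left vw)
    then show ?thesis using that by simp
  qed
  \<comment> \<open>The inner \<open>D\<close> on the left stays folded, so that
    \<open>coord\<close> can remove it.\<close>
  have "D (D x) = D x" for x
    by (subst (1 3) D_def) (simp add: coord)
  with \<open>bounded_clinear D\<close> show "idempotent_operator D"
    by (auto simp: idempotent_operator_def)
  have "D x \<in> cspan (v ` {..<k})" for x
    unfolding D_def
    by (intro complex_vector.span_sum complex_vector.span_scale complex_vector.span_base) auto
  then show "finite_rank D"
    unfolding finite_rank_def by (intro exI[of _ "v ` {..<k}"] conjI image_subsetI) simp_all
  \<comment> \<open>\<open>D (v 0)\<close> has inner product 1 with \<open>w 0\<close>.\<close>
  show "D \<noteq> (\<lambda>x. 0)" if "k > 0"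
    using coord[of 0 "v 0"] vw[of 0 0] that by auto
qed

text \<open>The basis is prescribed; only the operator is constructed, with rank \<open>k\<close>
  equal to the sum of the diagonal.\<close>

lemma idempotent_with_diagonal:
  fixes b :: "nat \<Rightarrow> 'a::complex_hilbert_space"
  assumes b: "orthonormal_basis b" and d: "summable (\<lambda>n. cmod (d n))"
    and k: "k > 0" "(\<Sum>n. d n) = of_nat k"
  obtains D :: "'a \<Rightarrow> 'a" where "idempotent_operator D" "finite_rank D" "D \<noteq> (\<lambda>x. 0)"
    "\<And>n. cinner (D (b n)) (b n) = d n"
proof -
  have bb: "cinner (b m) (b n) = (if m = n then 1 else 0)" for m n
    using b by (simp add: orthonormal_basis_def)
  have o: "orthonormal_on UNIV b"
    using b by (rule orthonormal_basis_imp_orthonormal)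
  define s where "s = (\<Sum>n. d (n + Suc k))"
  have sd: "summable d"
    using d by (rule summable_norm_cancel)
  have "(\<Sum>n. d n) = s + (\<Sum>n<Suc k. d n)"
    unfolding s_def by (rule suminf_split_initial_segment[OF sd])
  \<comment> \<open>The assumption on the sum, solved for \<open>d k\<close>; in this form the entry
    at \<open>k\<close> comes out of the construction.\<close>
  then have dk: "d k = (\<Sum>n<k. 1 - d n) - s"
    using k(2) by (simp add: sum_subtractf)
  \<comment> \<open>\<open>d n\<close> is split into two factors of modulus
    \<open>sqrt (cmod (d n))\<close>, so that summability of \<open>d\<close> makes both sequences
    square summable.\<close>
  define \<beta> where "\<beta> n = complex_of_real (sqrt (cmod (d n)))" for n
  define \<alpha> where "\<alpha> n = d n / \<beta> n" for n \<comment> \<open>0 if \<open>d n = 0\<close>\<close>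
  have \<alpha>\<beta>: "\<alpha> n * \<beta> n = d n" for n
    by (simp add: \<alpha>_def \<beta>_def)
  have norm\<beta>: "(cmod (\<beta> n))\<^sup>2 = cmod (d n)" for n
    by (simp add: \<beta>_def)
  have norm\<alpha>: "(cmod (\<alpha> n))\<^sup>2 = cmod (d n)" for n
    by (cases "d n = 0") (simp_all add: \<alpha>_def norm_divide power_divide norm\<beta> power2_eq_square[of "cmod (d n)"])
  \<comment> \<open>Since \<open>q k = 1\<close>, the coordinate \<open>- s\<close> of
    \<open>p\<close> cancels the tail sum \<open>s\<close> in the inner product of the two vectors.
    The zeros of \<open>p\<close> below \<open>k\<close> leave biorthogonality intact.\<close>
  define q where "q n = (if n < k then d n - 1 else if n = k then 1 else \<beta> n)" for n
  define p where "p n = (if n < k then 0 else if n = k then - s else \<alpha> n)" for n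
  have square_summable: "summable (\<lambda>n. (cmod (f n))\<^sup>2)" if "\<And>n. n > k \<Longrightarrow> (cmod (f n))\<^sup>2 = cmod (d n)" for f
    by (rule summable_cong[THEN iffD2, OF _ d]) (use that in \<open>auto simp: eventually_at_top_dense\<close>)
  obtain qv where qv: "\<And>n. cinner qv (b n) = q n"
    using orthonormal_vector_exists[OF o square_summable[of q]] by (auto simp: q_def norm\<beta>)
  \<comment> \<open>\<open>pv\<close> enters \<open>w 0\<close> and so stands in the second argument
    of \<open>cinner\<close>; conjugating its coordinates makes \<open>cinner (b n) pv\<close> equal
    to \<open>p n\<close>.\<close>
  obtain pv where "\<And>n. cinner pv (b n) = cnj (p n)"
    using orthonormal_vector_exists[OF o square_summable[of "\<lambda>n. cnj (p n)"]] by (auto simp: p_def norm\<alpha>)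
  then have pv: "cinner (b n) pv = p n" for n
    by (subst cinner_commute) simp
  have qp: "cinner qv pv = 0"
  proof -
    have "(\<lambda>n. q n * p n) sums cinner qv pv"
      using orthonormal_basis_parseval(1)[OF bounded_clinear_id b, of qv pv] by (simp add: qv pv)
    moreover have "(\<lambda>n. q n * p n) sums 0"
    proof -
      have "(\<lambda>n. q (n + Suc k) * p (n + Suc k)) sums s"
        using summable_sums[OF summable_ignore_initial_segment[OF sd, of "Suc k"]]
        by (simp add: q_def p_def s_def mult.commute[of "\<beta> _"] \<alpha>\<beta>)
      moreover have "(\<Sum>n<Suc k. q n * p n) = - s"
        by (simp add: q_def p_def)
      ultimately show ?thesis
        using sums_iff_shift[of "\<lambda>n. q n * p n" "Suc k" s] by simp
    qed
    ultimately show ?thesis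
      by (rule sums_unique2)
  qed
  define v where "v i = b i + qv" for i
  \<comment> \<open>\<open>pv\<close> is added to a single \<open>w i\<close>, so that each tail
    entry is produced once and not \<open>k\<close> times.\<close>
  define w where "w i = b i + cnj (1 - d i) *\<^sub>C b k + (if i = 0 then pv else 0)" for i
  have vb: "cinner (v i) (b n) = (if i = n then 1 else 0) + q n" for i n
    by (simp add: v_def cinner_add_left bb qv)
  have bw: "cinner (b n) (w i) =
      (if i = n then 1 else 0) + (if n = k then 1 - d i else 0) + (if i = 0 then p n else 0)" for i n
    by (simp add: w_def cinner_add_right cinner_scaleC_right bb pv)
  \<comment> \<open>After \<open>qp\<close> removes \<open>pv\<close>, what remains is
    \<open>q i + (1 - d i) * q k = (d i - 1) + (1 - d i)\<close>.\<close>
  have qw: "cinner qv (w i) = 0" if "i < k" for i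
    using that by (simp add: w_def cinner_add_right cinner_scaleC_right qv qp) (simp add: q_def)
  have vw: "cinner (v i) (w j) = (if i = j then 1 else 0)" if "i < k" "j < k" for i j
    using that by (simp add: v_def cinner_add_left qw bw p_def)
  define D where "D = (\<lambda>x. \<Sum>i<k. cinner x (w i) *\<^sub>C v i)"
  have diag: "cinner (D (b n)) (b n) = d n" for n
  proof -
    have "cinner (D (b n)) (b n) = (\<Sum>i<k. cinner (b n) (w i) * cinner (v i) (b n))"
      by (simp add: D_def cinner_sum_left cinner_scaleC_left)
    also have "\<dots> = d n"
    proof (cases n k rule: linorder_cases)
      \<comment> \<open>Among the \<open>w i\<close> only \<open>w n\<close> meets
        \<open>b n\<close>, and \<open>v n\<close> has coordinate \<open>1 + q n = d n\<close>
        there.\<close>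
      case less
      then have "(\<Sum>i<k. cinner (b n) (w i) * cinner (v i) (b n)) = (\<Sum>i<k. if i = n then d n else 0)"
        by (intro sum.cong) (auto simp: bw vb p_def q_def)
      then show ?thesis using less by simp
    next
      \<comment> \<open>Every \<open>v i\<close> has coordinate 1 at \<open>k\<close>, so the entry
        is the sum of the \<open>cinner (b k) (w i)\<close>.\<close>
      case equal
      then have "(\<Sum>i<k. cinner (b n) (w i) * cinner (v i) (b n))
          = (\<Sum>i<k. (1 - d i) + (if i = 0 then - s else 0))"
        by (intro sum.cong) (auto simp: bw vb p_def q_def)
      \<comment> \<open>As \<open>k > 0\<close>, the index 0 occurs and \<open>- s\<close> is
        counted exactly once.\<close>
      also have "\<dots> = (\<Sum>i<k. 1 - d i) - s"
        using k(1) unfolding sum.distrib by (simp del: sum_subtractf)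
      finally show ?thesis using equal dk by simp
    next
      \<comment> \<open>Only \<open>w 0\<close> meets \<open>b n\<close>, which leaves the product
        \<open>p n * q n\<close>.\<close>
      case greater
      then have "(\<Sum>i<k. cinner (b n) (w i) * cinner (v i) (b n)) = (\<Sum>i<k. if i = 0 then d n else 0)"
        by (intro sum.cong) (auto simp: bw vb p_def q_def \<alpha>\<beta>)
      then show ?thesis using k(1) by simp
    qed
    finally show ?thesis .
  qed
  show thesis
    using biorthogonal_idempotent[of k v w, OF vw] k(1) diag unfolding D_def[symmetric]
    by (intro that[of D]) auto
qed

theorem theorem4p3:
  fixes d :: "nat \<Rightarrow> complex"
  assumes separable: "\<exists>A :: 'a::complex_hilbert_space set. countable A \<and> closure A = UNIV"
    and infinite_dimensional: "\<nexists>B :: 'a set. finite B \<and> cspan B = UNIV"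
  shows "(\<exists>(D :: 'a \<Rightarrow> 'a) (b :: nat \<Rightarrow> 'a).
            idempotent_operator D \<and> finite_rank D \<and> D \<noteq> (\<lambda>x. 0) \<and>
            orthonormal_basis b \<and> (\<forall>n. cinner (D (b n)) (b n) = d n))
     \<longleftrightarrow> summable (\<lambda>n. cmod (d n)) \<and>
         (\<exists>k::nat. k > 0 \<and> (\<Sum>n. d n) = of_nat k)"
  (is "?L \<longleftrightarrow> ?R")
proof
  assume ?L
  then obtain D :: "'a \<Rightarrow> 'a" and b where D: "idempotent_operator D" "finite_rank D" "D \<noteq> (\<lambda>x. 0)"
    "orthonormal_basis b" "\<And>n. cinner (D (b n)) (b n) = d n"
    by blast
  obtain m :: nat where m: "m = 0 \<longrightarrow> D = (\<lambda>x. 0)" "d sums of_nat m" "summable (\<lambda>n. cmod (d n))"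
    using finite_rank_idempotent_diagonal[OF D(1,2,4)] unfolding D(5) by blast
  then show ?R
    using D(3) by (metis gr0I sums_unique)
next
  assume ?R
  then obtain k where d: "summable (\<lambda>n. cmod (d n))" "k > 0" "(\<Sum>n. d n) = of_nat k"
    by blast
  \<comment> \<open>Any orthonormal basis will do, since the operator is built to fit it.\<close>
  obtain b :: "nat \<Rightarrow> 'a" where b: "orthonormal_basis b"
    using separable infinite_dimensional orthonormal_basis_exists by metis
  have "\<exists>D :: 'a \<Rightarrow> 'a. idempotent_operator D \<and> finite_rank D \<and> D \<noteq> (\<lambda>x. 0) \<and>
      (\<forall>n. cinner (D (b n)) (b n) = d n)"
    using idempotent_with_diagonal[OF b d] by blast
  then show ?L
    using b by blast
qed

end
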